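(* Let $n\ge 2$, let $A\in\mathbb{Z}^{n\times n}$, $\mathbf{v},\mathbf{w}\in\mathbb{Z}^n$, and $\hat A=A+\mathbf{v}\mathbf{w}^T$, and suppose all leading principal minors of $A$ and of $\hat A$ are nonzero (in particular both are nonsingular). Let $LD^{-1}U$ and $\hat L\hat D^{-1}\hat U$ be the REF-LU factorizations of $A$ and $\hat A$, respectively. Let $\mathbf{y}^{(k)}$ and $\mathbf{z}^{(k)}$ denote the vectors output after the $k$th iteration of the stepwise recursion of REF forward substitution performed on $\mathbf{v}$ using $L$ and on $\mathbf{w}$ using $U^T$, respectively, for $k=1,\dots,n-1$. Assume that $y^{(k-1)}_k\ne 0$ and $z^{(k-1)}_k\ne 0$ for $k=2,\dots,n-1$. Then the algorithm REF-ROU, run on input $L$, $U$, $\mathbf{v}$, $\mathbf{w}$ and the diagonal of $A$, successfully obtains the REF-LU factorization of $\hat A$ without roundoff errors; that is, its output matrices are exactly $\hat L$ and $\hat U$, and every division it performs is an exact division of integers (the dividend is an integer multiple of the nonzero divisor).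
   Context: REF-LU factorization. Let $M\in\mathbb{Z}^{n\times n}$ have all leading principal minors nonzero. Integer-preserving Gaussian elimination (IPGE) on $M$ (no permutations): $m^{(0)}_{i,j}=m_{i,j}$, $\rho^{(0)}=1$, and for $k=1,\dots,n$, with pivot $\rho^{(k)}=m^{(k-1)}_{k,k}$, set, for $k\le i,j\le n$, $m^{(k)}_{i,j}=m^{(k-1)}_{i,j}$ if $i=k$, and $m^{(k)}_{i,j}=\bigl(\rho^{(k)}m^{(k-1)}_{i,j}-m^{(k-1)}_{k,j}m^{(k-1)}_{i,k}\bigr)/\rho^{(k-1)}$ otherwise. (All these entries are integers, and $\rho^{(k)}$ is the $k$th leading principal minor of $M$.) The REF-LU factorization of $M$ is the triple $L,D,U$ where $L$ is lower triangular with $l_{i,j}=m^{(j-1)}_{i,j}$ for $i\ge j$, $D$ is diagonal with $d_{i,i}=\rho^{(i-1)}\rho^{(i)}$, and $U$ is upper triangular with $u_{i,j}=m^{(i-1)}_{i,j}$ for $i\le j$; it satisfies $M=LD^{-1}U$ and $l_{i,i}=u_{i,i}=\rho^{(i)}$. $D$ is recovered from the diagonal of $L$, so only $L,U$ are stored. REF forward substitution. For $\mathbf{b}$ and a lower-triangular $\Lambda=(\lambda_{i,j})$ (here $\Lambda=L$ or $\Lambda=U^T$), with $\lambda_{0,0}=1$: $\mathbf{y}^{(0)}=\mathbf{b}$ and, for $k=1,\dots,n-1$, $y^{(k)}_i=y^{(k-1)}_i$ for $i\le k$ and $y^{(k)}_i=\bigl(\lambda_{k,k}y^{(k-1)}_i-\lambda_{i,k}y^{(k-1)}_k\bigr)/\lambda_{k-1,k-1}$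 for $i>k$. Write $\mathbf{y}^{(k)}=\text{Step}(\mathbf{y}^{(k-1)},\Lambda,k)$. Algorithm REF-ROU. Input $L,U,\mathbf{v},\mathbf{w}$ and the diagonal entries $a_{i,i}$ of $A$. The working arrays $\hat l,\hat u$ (with $\hat l_{0,0}=\hat u_{0,0}=1$, and zeros above, respectively below, the diagonal) are filled as follows; the diagonals $\hat l_{i,i}$ and $\hat u_{i,i}$ are always assigned the same value. 1. $\hat l_{1,1}=\hat u_{1,1}:=a_{1,1}+v_1w_1$. For $i=2,\dots,n$: $\hat u_{1,i}:=u_{1,i}+v_1w_i$; $\hat l_{i,1}:=l_{i,1}+v_iw_1$; $\hat l_{i,i}=\hat u_{i,i}:=a_{i,i}+v_iw_i$. 2. $\mathbf{y}^{(0)}:=\mathbf{v}$, $\mathbf{z}^{(0)}:=\mathbf{w}$, $\mathbf{y}^{(1)}:=\text{Step}(\mathbf{y}^{(0)},L,1)$, $\mathbf{z}^{(1)}:=\text{Step}(\mathbf{z}^{(0)},U^T,1)$. 3. For $k=2,\dots,n-1$: set $\mathbf{y}^{(k)}:=\text{Step}(\mathbf{y}^{(k-1)},L,k)$ and $\mathbf{z}^{(k)}:=\text{Step}(\mathbf{z}^{(k-1)},U^T,k)$; then for $i=k,\dots,n$ (in this order): (a) $\hat l_{i,i}=\hat u_{i,i}\leftarrow\bigl(\hat l_{k-1,k-1}\hat l_{i,i}-\hat u_{k-1,i}\hat l_{i,k-1}\bigr)/\hat l_{k-2,k-2}$; (b) if $i>k$, $\hat l_{i,k}:=\bigl(\hat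 l_{k,k}y^{(k-1)}_i-\hat l_{k-1,k-1}y^{(k)}_i\bigr)/y^{(k-1)}_k$ and $\hat u_{k,i}:=\bigl(\hat u_{k,k}z^{(k-1)}_i-\hat u_{k-1,k-1}z^{(k)}_i\bigr)/z^{(k-1)}_k$. 4. $\hat l_{n,n}=\hat u_{n,n}\leftarrow\bigl(\hat l_{n-1,n-1}\hat l_{n,n}-\hat u_{n-1,n}\hat l_{n,n-1}\bigr)/\hat l_{n-2,n-2}$. Return $\hat l,\hat u$. *)

theory Defs
  imports "Jordan_Normal_Form.Determinant" "HOL-Library.Monad_Syntax"
begin

(* The library's matrices and vectors are 0-based. mat_ent, vec_ent and mat_of_ent translate to and
   from indices 1..n, so that the formulas below carry the usual 1-based indices. The extra value
   mat_ent X 0 0 = 1 is the convention x_{0,0} = 1 for triangular factors. *)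

definition mat_ent :: "rat mat \<Rightarrow> nat \<Rightarrow> nat \<Rightarrow> rat" where
  "mat_ent X i j = (if i = 0 \<and> j = 0 then 1 else X $$ (i - 1, j - 1))"

definition vec_ent :: "int vec \<Rightarrow> nat \<Rightarrow> rat" where
  "vec_ent b i = of_int (b $ (i - 1))"

definition mat_of_ent :: "nat \<Rightarrow> (nat \<Rightarrow> nat \<Rightarrow> rat) \<Rightarrow> rat mat" where
  "mat_of_ent n f = mat n n (\<lambda>(i, j). f (i + 1) (j + 1))"

definition leading_principal_minor :: "int mat \<Rightarrow> nat \<Rightarrow> int" where
  "leading_principal_minor M k = det (mat k k (\<lambda>(i, j). M $$ (i, j)))"

(* ipge M k i j is m^(k)_{i,j}, meaningful for k \<le> i, j \<le> n, and pivot M k is rho^(k). The division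
   is the one of the rationals, so integrality of the entries is not built in. *)

fun ipge :: "int mat \<Rightarrow> nat \<Rightarrow> nat \<Rightarrow> nat \<Rightarrow> rat"
  and pivot :: "int mat \<Rightarrow> nat \<Rightarrow> rat" where
  "ipge M 0 i j = of_int (M $$ (i - 1, j - 1))"
| "ipge M (Suc k) i j =
     (if i = Suc k then ipge M k i j
      else (pivot M (Suc k) * ipge M k i j - ipge M k (Suc k) j * ipge M k i (Suc k)) / pivot M k)"
| "pivot M 0 = 1"
| "pivot M (Suc k) = ipge M k (Suc k) (Suc k)"

definition REF_LU :: "int mat \<Rightarrow> rat mat \<times> rat mat \<times> rat mat" where
  "REF_LU M = (let n = dim_row M in
     (mat_of_ent n (\<lambda>i j. if j \<le> i then ipge M (j - 1) i j else 0),
      mat_of_ent n (\<lambda>i j. if i = j then pivot M (i - 1) * pivot M i else 0),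
      mat_of_ent n (\<lambda>i j. if i \<le> j then ipge M (i - 1) i j else 0)))"

(* Working vectors and arrays of the algorithms are functions of 1-based indices. *)

definition ref_step :: "rat mat \<Rightarrow> nat \<Rightarrow> (nat \<Rightarrow> rat) \<Rightarrow> nat \<Rightarrow> rat" where
  "ref_step \<Lambda> k y i =
     (if i \<le> k then y i
      else (mat_ent \<Lambda> k k * y i - mat_ent \<Lambda> i k * y k) / mat_ent \<Lambda> (k - 1) (k - 1))"

primrec fwd_subst :: "rat mat \<Rightarrow> int vec \<Rightarrow> nat \<Rightarrow> nat \<Rightarrow> rat" where
  "fwd_subst \<Lambda> b 0 = vec_ent b"
| "fwd_subst \<Lambda> b (Suc k) = ref_step \<Lambda> (Suc k) (fwd_subst \<Lambda> b k)"

definition exact_division :: "rat \<Rightarrow> rat \<Rightarrow> bool" where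
  "exact_division a b \<longleftrightarrow> (\<exists>p q :: int. a = of_int p \<and> b = of_int q \<and> q \<noteq> 0 \<and> q dvd p)"

(* The algorithm runs in the option monad and fails as soon as one of its divisions is not an exact
   division of integers. *)

definition xdiv :: "rat \<Rightarrow> rat \<Rightarrow> rat option" where
  "xdiv a b = (if exact_division a b then Some (a / b) else None)"

primrec for_loop :: "nat list \<Rightarrow> (nat \<Rightarrow> 's \<Rightarrow> 's option) \<Rightarrow> 's \<Rightarrow> 's option" where
  "for_loop [] body s = Some s"
| "for_loop (k # ks) body s = do { s' \<leftarrow> body k s; for_loop ks body s' }"

definition ref_step_exact ::
    "nat \<Rightarrow> rat mat \<Rightarrow> nat \<Rightarrow> (nat \<Rightarrow> rat) \<Rightarrow> (nat \<Rightarrow> rat) option" where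
  "ref_step_exact n \<Lambda> k y =
     (if \<forall>i\<in>{k<..n}.
           exact_division (mat_ent \<Lambda> k k * y i - mat_ent \<Lambda> i k * y k) (mat_ent \<Lambda> (k - 1) (k - 1))
      then Some (ref_step \<Lambda> k y) else None)"

type_synonym array = "nat \<Rightarrow> nat \<Rightarrow> rat"

definition update :: "array \<Rightarrow> nat \<Rightarrow> nat \<Rightarrow> rat \<Rightarrow> array" where
  "update f i j x = f(i := (f i)(j := x))"

definition rou_init ::
    "nat \<Rightarrow> rat mat \<Rightarrow> rat mat \<Rightarrow> int vec \<Rightarrow> int vec \<Rightarrow> int vec \<Rightarrow> array \<times> array" where
  "rou_init n L U v w a =
     ((\<lambda>i j. if i = 0 \<and> j = 0 then 1
             else if i \<in> {1..n} \<and> j = i then vec_ent a i + vec_ent v i * vec_ent w i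
             else if i \<in> {2..n} \<and> j = 1 then mat_ent L i 1 + vec_ent v i * vec_ent w 1
             else 0),
      (\<lambda>i j. if i = 0 \<and> j = 0 then 1
             else if i \<in> {1..n} \<and> j = i then vec_ent a i + vec_ent v i * vec_ent w i
             else if i = 1 \<and> j \<in> {2..n} then mat_ent U 1 j + vec_ent v 1 * vec_ent w j
             else 0))"

definition rou_diag :: "nat \<Rightarrow> nat \<Rightarrow> array \<times> array \<Rightarrow> (array \<times> array) option" where
  "rou_diag k i = (\<lambda>(l, u). do {
     d \<leftarrow> xdiv (l (k - 1) (k - 1) * l i i - u (k - 1) i * l i (k - 1)) (l (k - 2) (k - 2));
     Some (update l i i d, update u i i d) })"

(* y, z are y^(k-1), z^(k-1) and y', z' are y^(k), z^(k) *)
definition rou_offdiag ::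
    "nat \<Rightarrow> (nat \<Rightarrow> rat) \<Rightarrow> (nat \<Rightarrow> rat) \<Rightarrow> (nat \<Rightarrow> rat) \<Rightarrow> (nat \<Rightarrow> rat) \<Rightarrow> nat
      \<Rightarrow> array \<times> array \<Rightarrow> (array \<times> array) option" where
  "rou_offdiag k y y' z z' i = (\<lambda>(l, u). do {
     p \<leftarrow> xdiv (l k k * y i - l (k - 1) (k - 1) * y' i) (y k);
     q \<leftarrow> xdiv (u k k * z i - u (k - 1) (k - 1) * z' i) (z k);
     Some (update l i k p, update u k i q) })"

definition REF_ROU ::
    "nat \<Rightarrow> rat mat \<Rightarrow> rat mat \<Rightarrow> int vec \<Rightarrow> int vec \<Rightarrow> int vec \<Rightarrow> (rat mat \<times> rat mat) option" where
  "REF_ROU n L U v w a = do {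
     y1 \<leftarrow> ref_step_exact n L 1 (vec_ent v);
     z1 \<leftarrow> ref_step_exact n (transpose_mat U) 1 (vec_ent w);
     (y, z, lu) \<leftarrow> for_loop [2..<n] (\<lambda>k (y, z, lu). do {
         y' \<leftarrow> ref_step_exact n L k y;
         z' \<leftarrow> ref_step_exact n (transpose_mat U) k z;
         lu' \<leftarrow> for_loop [k..<n + 1] (\<lambda>i lu. do {
             lu' \<leftarrow> rou_diag k i lu;
             if i > k then rou_offdiag k y y' z z' i lu' else Some lu' }) lu;
         Some (y', z', lu') }) (y1, z1, rou_init n L U v w a);
     (l, u) \<leftarrow> rou_diag n n lu;
     Some (mat_of_ent n l, mat_of_ent n u) }"

end

(* By an LU factorization, the IPGE entry m^(k)_{i,j} is the determinant of the leading k x k block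
   of M bordered by row i and column j; hence it is an integer. Forward substitution with L is IPGE
   applied to an additional column v, so y^(k)_i is the bordered minor of [A | v]. The columns of
   Ahat differ from those of A by multiples of v, so [Ahat | v] has the same bordered minors.
   Therefore y^(k) also obeys the IPGE recursion with the entries of Ahat in place of those of A;
   solving that recursion for lhat_{i,k} gives the off-diagonal formula of the algorithm. The
   statements about U and w follow by transposition. *)

theory Submission imports Defs begin

section \<open>IPGE entries as bordered minors\<close>

text \<open>\<open>i\<close> and \<open>j\<close> are 1-based as in \<open>ipge\<close>, while
  matrix positions are 0-based; hence only the bordering row and column are shifted.\<close>

definition bordered :: "int mat \<Rightarrow> nat \<Rightarrow> nat \<Rightarrow> nat \<Rightarrow> int mat" where
  "bordered M k i j = mat (Suc k) (Suc k)
     (\<lambda>(p, q). M $$ (if p < k then p else i - 1, if q < k then q else j - 1))"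

lemma bordered_carrier [simp]: "bordered M k i j \<in> carrier_mat (Suc k) (Suc k)"
  by (simp add: bordered_def)

lemma det_bordered_diag: "det (bordered M k (Suc k) (Suc k)) = leading_principal_minor M (Suc k)"
proof -
  have "bordered M k (Suc k) (Suc k) = mat (Suc k) (Suc k) (\<lambda>(p, q). M $$ (p, q))"
    by (rule eq_matI) (auto simp: bordered_def less_Suc_eq)
  then show ?thesis by (simp add: leading_principal_minor_def)
qed

text \<open>One elimination step, divided by the product of the old and the new pivot, splits a
  rank-one term off \<open>ipge M k i j / pivot M k\<close>. Summing these terms gives the LU
  factorization stopped after \<open>k\<close> steps, with its remainder.\<close>

lemma ipge_telescope:
  assumes "\<And>t. t \<le> k \<Longrightarrow> pivot M t \<noteq> 0" and "k < i"
  shows "of_int (M $$ (i - 1, j - 1)) =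
    (\<Sum>t<k. ipge M t i (Suc t) * ipge M t (Suc t) j / (pivot M t * pivot M (Suc t)))
      + ipge M k i j / pivot M k"
  using assms
proof (induction k)
  case 0
  then show ?case by simp
next
  case (Suc k)
  have nz: "pivot M k \<noteq> 0" "pivot M (Suc k) \<noteq> 0"
    using Suc.prems(1) by (auto simp del: pivot.simps)
  have "ipge M k i j / pivot M k =
      ipge M k i (Suc k) * ipge M k (Suc k) j / (pivot M k * pivot M (Suc k))
      + ipge M (Suc k) i j / pivot M (Suc k)"
    using nz Suc.prems(2) by (simp add: field_simps del: pivot.simps)
  then show ?case
    using Suc by (simp del: ipge.simps pivot.simps)
qed

declare ipge.simps [simp del] pivot.simps [simp del]

text \<open>The bordered matrix factors as \<open>F * G\<close> with \<open>F\<close> unit lower and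
  \<open>G\<close> upper triangular. The first \<open>k\<close> diagonal entries of \<open>G\<close>
  are quotients of consecutive pivots; their product \<open>pivot M k\<close> cancels the
  denominator of the last entry. The assumption is on pivots because their identification with
  minors is derived from this lemma.\<close>

lemma ipge_eq_det_bordered_if_pivots:
  assumes nz: "\<And>t. t \<le> k \<Longrightarrow> pivot M t \<noteq> 0" and "k < i" "k < j"
  shows "ipge M k i j = of_int (det (bordered M k i j))"
proof -
  \<comment> \<open>\<open>r\<close> and \<open>c\<close> translate positions in the bordered matrix
    to 1-based row and column indices of \<open>M\<close>.\<close>
  define r where "r p = (if p < k then Suc p else i)" for p
  define c where "c q = (if q < k then Suc q else j)" for q
  define F where "F = mat (Suc k) (Suc k) (\<lambda>(p, t).
    if t < k then if t \<le> p then ipge M t (r p) (Suc t) / pivot M (Suc t) else 0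
    else if p = t then 1 else 0)"
  define G where "G = mat (Suc k) (Suc k) (\<lambda>(t, q).
    if t < k then if t \<le> q then ipge M t (Suc t) (c q) / pivot M t else 0
    else if q = t then ipge M k i j / pivot M k else 0)"
  have carr: "F \<in> carrier_mat (Suc k) (Suc k)" "G \<in> carrier_mat (Suc k) (Suc k)"
    by (simp_all add: F_def G_def)
  have "map_mat of_int (bordered M k i j) = F * G"
  proof (rule eq_matI)
    fix p q assume "p < dim_row (F * G)" and "q < dim_col (F * G)"
    then have p: "p \<le> k" and q: "q \<le> k" using carr by auto
    \<comment> \<open>Triangularity ends the inner product at index \<open>min p q\<close>; the
      terms before it are the telescoped ones, and the last one is the remainder.\<close>
    define m where "m = min p q"
    define h where "h t = ipge M t (r p) (Suc t) * ipge M t (Suc t) (c q)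
      / (pivot M t * pivot M (Suc t))" for t
    have mk: "m \<le> k" "m < r p"
      using p q assms(2) by (auto simp: m_def r_def)
    have "(F * G) $$ (p, q) = (\<Sum>t<Suc k. F $$ (p, t) * G $$ (t, q))"
      using p q carr by (simp add: scalar_prod_def lessThan_atLeast0)
    also have "\<dots> = (\<Sum>t<Suc m. F $$ (p, t) * G $$ (t, q))"
      using p q by (intro sum.mono_neutral_right) (auto simp: F_def G_def m_def)
    also have "\<dots> = (\<Sum>t<m. F $$ (p, t) * G $$ (t, q)) + F $$ (p, m) * G $$ (m, q)"
      by simp
    also have "(\<Sum>t<m. F $$ (p, t) * G $$ (t, q)) = (\<Sum>t<m. h t)"
      using p q by (intro sum.cong) (auto simp: F_def G_def m_def h_def)
    also have "F $$ (p, m) * G $$ (m, q) = ipge M m (r p) (c q) / pivot M m"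
    proof (cases "m < k")
      case True
      \<comment> \<open>Since \<open>m\<close> is \<open>p\<close> or \<open>q\<close>, one of the
        two factors is a diagonal entry. Its numerator is \<open>pivot M (Suc m)\<close>, which
        cancels the denominator contributed by \<open>F\<close>.\<close>
      then have "r p = Suc m \<or> c q = Suc m" by (auto simp: m_def r_def c_def min_def)
      moreover have "pivot M (Suc m) \<noteq> 0" "pivot M (Suc m) = ipge M m (Suc m) (Suc m)"
        using nz [of "Suc m"] True by (auto simp: pivot.simps)
      ultimately show ?thesis
        using True p q by (auto simp: F_def G_def m_def)
    next
      case False
      then have "p = k" "q = k" "m = k" using p q by (auto simp: m_def)
      then show ?thesis by (simp add: F_def G_def r_def c_def)
    qed
    also have "(\<Sum>t<m. h t) + ipge M m (r p) (c q) / pivot M m = of_int (M $$ (r p - 1, c q - 1))"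
      unfolding h_def by (rule ipge_telescope [symmetric]) (use nz mk in auto)
    also have "\<dots> = map_mat of_int (bordered M k i j) $$ (p, q)"
      using p q by (simp add: bordered_def r_def c_def)
    finally show "map_mat of_int (bordered M k i j) $$ (p, q) = (F * G) $$ (p, q)" ..
  qed (use carr in \<open>auto simp: bordered_def\<close>)
  then have "of_int (det (bordered M k i j)) = det F * det G"
    using det_mult [OF carr] by (metis of_int_hom.hom_det)
  also have "det F = (\<Prod>t = 0..<Suc k. F $$ (t, t))"
    using carr by (subst det_lower_triangular [of "Suc k"]) (auto simp: prod_list_diag_prod F_def)
  also have "\<dots> = 1"
  proof (rule prod.neutral, rule ballI)
    fix t assume "t \<in> {0..<Suc k}"
    then show "F $$ (t, t) = 1"
      using nz [of "Suc t"] by (auto simp: F_def r_def pivot.simps less_Suc_eq)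
  qed
  also have "det G = (\<Prod>t = 0..<Suc k. G $$ (t, t))"
    using carr
    by (subst det_upper_triangular [of _ "Suc k"]) (auto simp: prod_list_diag_prod G_def)
  also have "\<dots> = (\<Prod>t<k. G $$ (t, t)) * G $$ (k, k)"
    by (simp add: lessThan_atLeast0)
  also have "(\<Prod>t<k. G $$ (t, t)) = (\<Prod>t<k. pivot M (Suc t) / pivot M t)"
    by (rule prod.cong) (auto simp: G_def c_def pivot.simps)
  also have "\<dots> = pivot M k"
  proof -
    have "m \<le> k \<Longrightarrow> (\<Prod>t<m. pivot M (Suc t) / pivot M t) = pivot M m" for m
      by (induction m) (auto simp: nz pivot.simps(1))
    then show ?thesis by simp
  qed
  also have "1 * (pivot M k * G $$ (k, k)) = ipge M k i j"
    using nz [of k] by (simp add: G_def)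
  finally show ?thesis ..
qed

text \<open>Strong induction avoids a circle: nonzero smaller minors make the earlier pivots
  nonzero, which permits the bordered-minor formula for the next pivot.\<close>

lemma pivot_eq_minor:
  assumes "\<And>t. \<lbrakk>1 \<le> t; t \<le> k\<rbrakk> \<Longrightarrow> leading_principal_minor M t \<noteq> 0"
  shows "pivot M k = of_int (leading_principal_minor M k)"
  using assms
proof (induction k rule: less_induct)
  case (less k)
  show ?case
  proof (cases k)
    case 0
    then show ?thesis by (simp add: leading_principal_minor_def pivot.simps det_dim_zero)
  next
    case (Suc m)
    have "pivot M t \<noteq> 0" if "t \<le> m" for t
      using that less Suc by (cases "t = 0") (auto simp: pivot.simps(1))
    then show ?thesis
      using Suc by (simp add: pivot.simps(2) ipge_eq_det_bordered_if_pivots det_bordered_diag)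
  qed
qed

lemma pivot_nonzero:
  assumes "\<And>t. \<lbrakk>1 \<le> t; t \<le> k\<rbrakk> \<Longrightarrow> leading_principal_minor M t \<noteq> 0"
  shows "pivot M k \<noteq> 0"
  using assms by (cases "k = 0") (auto simp: pivot_eq_minor pivot.simps(1))

lemma ipge_eq_det_bordered:
  assumes "\<And>t. \<lbrakk>1 \<le> t; t \<le> k\<rbrakk> \<Longrightarrow> leading_principal_minor M t \<noteq> 0" and "k < i" "k < j"
  shows "ipge M k i j = of_int (det (bordered M k i j))"
  using assms by (intro ipge_eq_det_bordered_if_pivots pivot_nonzero) auto

text \<open>The recursion with its denominator cleared; read through bordered minors it is the
  Desnanot-Jacobi identity. The division identities for the algorithm are instances of it.\<close>

lemma ipge_step:
  assumes "\<And>t. \<lbrakk>1 \<le> t; t \<le> k\<rbrakk> \<Longrightarrow> leading_principal_minor M t \<noteq> 0" and "Suc k < i"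
  shows "pivot M (Suc k) * ipge M k i j - ipge M k (Suc k) j * ipge M k i (Suc k)
    = ipge M (Suc k) i j * pivot M k"
  using assms pivot_nonzero [of k M] by (simp add: ipge.simps)

section \<open>Dependence on the leading block, and transposition\<close>

lemma ipge_cong:
  assumes "\<And>i j. \<lbrakk>i \<le> m; j \<le> m\<rbrakk> \<Longrightarrow> M $$ (i - 1, j - 1) = N $$ (i - 1, j - 1)"
  shows "\<lbrakk>k < i; k < j; i \<le> m; j \<le> m\<rbrakk> \<Longrightarrow> ipge M k i j = ipge N k i j"
    and "k \<le> m \<Longrightarrow> pivot M k = pivot N k"
proof (induction k arbitrary: i j)
  case 0
  { case 1 then show ?case using assms by (simp add: ipge.simps) }
  { case 2 then show ?case by (simp add: pivot.simps) }
next
  case (Suc k)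
  { case 1 then show ?case using Suc by (auto simp: ipge.simps pivot.simps) }
  { case 2 then show ?case using Suc by (simp add: pivot.simps) }
qed

text \<open>The only asymmetric branch of the recursion copies the pivot row. It is never taken
  while both indices exceed \<open>k\<close>.\<close>

lemma ipge_transpose:
  assumes "M \<in> carrier_mat n n"
  shows "\<lbrakk>k < i; k < j; i \<le> n; j \<le> n\<rbrakk> \<Longrightarrow> ipge (transpose_mat M) k i j = ipge M k j i"
    and "k \<le> n \<Longrightarrow> pivot (transpose_mat M) k = pivot M k"
proof (induction k arbitrary: i j)
  case 0
  { case 1 then show ?case using assms by (simp add: ipge.simps) }
  { case 2 then show ?case by (simp add: pivot.simps) }
next
  case (Suc k)
  { case 1 then show ?case using Suc by (auto simp: ipge.simps pivot.simps) }
  { case 2 then show ?case using Suc by (simp add: pivot.simps) }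
qed

lemma leading_principal_minor_transpose:
  assumes "M \<in> carrier_mat n n" "k \<le> n"
  shows "leading_principal_minor (transpose_mat M) k = leading_principal_minor M k"
proof -
  have "mat k k (\<lambda>(i, j). transpose_mat M $$ (i, j)) = transpose_mat (mat k k (\<lambda>(i, j). M $$ (i, j)))"
    using assms by (intro eq_matI) auto
  then show ?thesis
    by (simp add: leading_principal_minor_def det_transpose [of _ k])
qed

section \<open>Forward substitution as elimination of an appended column\<close>

text \<open>With the vector stored as column \<open>Suc n\<close>, forward substitution inherits the
  facts about \<open>ipge\<close>, integrality included.\<close>

definition append_col :: "nat \<Rightarrow> int mat \<Rightarrow> int vec \<Rightarrow> int mat" where
  "append_col n M b = mat n (Suc n) (\<lambda>(i, j). if j < n then M $$ (i, j) else b $ i)"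

lemma ipge_append_col:
  shows "\<lbrakk>k < i; k < j; i \<le> n; j \<le> n\<rbrakk> \<Longrightarrow> ipge (append_col n M b) k i j = ipge M k i j"
    and "k \<le> n \<Longrightarrow> pivot (append_col n M b) k = pivot M k"
proof -
  have *: "append_col n M b $$ (i - 1, j - 1) = M $$ (i - 1, j - 1)"
    if "n \<noteq> 0" "i \<le> n" "j \<le> n" for i j
    using that by (auto simp: append_col_def)
  show "ipge (append_col n M b) k i j = ipge M k i j" if "k < i" "k < j" "i \<le> n" "j \<le> n"
    using that by (intro ipge_cong(1) [of n] *) auto
  show "pivot (append_col n M b) k = pivot M k" if "k \<le> n"
  \<comment> \<open>\<open>ipge_cong\<close> also compares index 0, which truncated subtraction
    sends to entry (0, 0); the appended matrix has no such entry when \<open>n\<close> is 0.\<close>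
  proof (cases "n = 0")
    case True
    with that show ?thesis by (simp add: pivot.simps)
  next
    case False
    then show ?thesis using that by (intro ipge_cong(2) [of n] *) auto
  qed
qed

lemma leading_principal_minor_append_col:
  assumes "k \<le> n"
  shows "leading_principal_minor (append_col n M b) k = leading_principal_minor M k"
proof -
  have "mat k k (\<lambda>(i, j). append_col n M b $$ (i, j)) = mat k k (\<lambda>(i, j). M $$ (i, j))"
    using assms by (intro eq_matI) (auto simp: append_col_def)
  then show ?thesis by (simp add: leading_principal_minor_def)
qed

text \<open>Column \<open>k\<close> of the factor holds the multipliers of elimination step
  \<open>k\<close>, so both recursions coincide. The abstract factor covers \<open>L\<close> for
  \<open>A\<close> as well as the transposed \<open>U\<close> for the transposed
  \<open>A\<close>.\<close>

lemma fwd_subst_eq_ipge: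
  assumes "\<And>i j. \<lbrakk>1 \<le> j; j \<le> i; i \<le> n\<rbrakk> \<Longrightarrow> mat_ent \<Lambda> i j = ipge M (j - 1) i j"
  shows "\<lbrakk>k < i; i \<le> n\<rbrakk> \<Longrightarrow> fwd_subst \<Lambda> b k i = ipge (append_col n M b) k i (Suc n)"
proof (induction k arbitrary: i)
  case 0
  then show ?case by (simp add: ipge.simps append_col_def vec_ent_def)
next
  case (Suc k)
  \<comment> \<open>At \<open>k = 0\<close> the convention for entry (0, 0) matches
    \<open>pivot M 0 = 1\<close>.\<close>
  have "mat_ent \<Lambda> k k = pivot M k"
    using assms [of k k] Suc.prems by (cases k) (auto simp: mat_ent_def pivot.simps)
  then show ?case
    using Suc assms [of "Suc k" "Suc k"] assms [of "Suc k" i]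
    by (simp add: ref_step_def ipge.simps ipge_append_col pivot.simps(2))
qed

section \<open>Bordered minors under a rank-one update\<close>

locale rank_one_update =
  fixes n :: nat and A B :: "int mat" and v w :: "int vec"
  assumes carrier: "A \<in> carrier_mat n n" "B \<in> carrier_mat n n"
    and entry: "\<And>i j. \<lbrakk>i < n; j < n\<rbrakk> \<Longrightarrow> B $$ (i, j) = A $$ (i, j) + v $ i * w $ j"
    and minor_A: "\<And>k. \<lbrakk>1 \<le> k; k \<le> n\<rbrakk> \<Longrightarrow> leading_principal_minor A k \<noteq> 0"
    and minor_B: "\<And>k. \<lbrakk>1 \<le> k; k \<le> n\<rbrakk> \<Longrightarrow> leading_principal_minor B k \<noteq> 0"
begin

text \<open>Transposing the update exchanges \<open>v\<close> and \<open>w\<close>. Each fact about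
  \<open>L\<close> and \<open>v\<close> thereby yields its counterpart for \<open>U\<close> and
  \<open>w\<close> by interpretation.\<close>

lemma transposed: "rank_one_update n (transpose_mat A) (transpose_mat B) w v"
  using carrier
  by unfold_locales
    (auto simp: entry leading_principal_minor_transpose minor_A minor_B mult.commute)

lemma ipge_Ints:
  assumes "k < i" "k < j" "i \<le> n" "j \<le> n"
  shows "ipge B k i j \<in> \<int>"
  using assms by (subst ipge_eq_det_bordered) (auto simp: minor_B)

lemma pivot_Ints: "k \<le> n \<Longrightarrow> pivot A k \<in> \<int>" "k \<le> n \<Longrightarrow> pivot B k \<in> \<int>"
  by (auto simp: pivot_eq_minor minor_A minor_B)

lemma pivots_nonzero: "k \<le> n \<Longrightarrow> pivot A k \<noteq> 0" "k \<le> n \<Longrightarrow> pivot B k \<noteq> 0"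
  by (auto intro!: pivot_nonzero simp: minor_A minor_B)

abbreviation y :: "nat \<Rightarrow> nat \<Rightarrow> rat" where
  "y k i \<equiv> ipge (append_col n A v) k i (Suc n)"

text \<open>Column \<open>j\<close> of \<open>B\<close> is column \<open>j\<close> of \<open>A\<close> plus a multiple of \<open>v\<close>, and \<open>v\<close> is itself the last
  column of the bordered minor.\<close>

lemma y_updated:
  assumes "k < i" "i \<le> n"
  shows "y k i = ipge (append_col n B v) k i (Suc n)"
proof -
  \<comment> \<open>Right multiplication by \<open>E\<close> adds \<open>w $ q\<close> times the
    last column to each earlier column \<open>q\<close>; it is unit lower triangular, so
    determinants are kept.\<close>
  define E :: "int mat" where "E = mat (Suc k) (Suc k)
    (\<lambda>(p, q). if p = q then 1 else if p = k then w $ q else 0)"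
  let ?A = "bordered (append_col n A v) k i (Suc n)"
  let ?B = "bordered (append_col n B v) k i (Suc n)"
  have E: "E \<in> carrier_mat (Suc k) (Suc k)" by (simp add: E_def)
  have "?B = ?A * E"
  proof (rule eq_matI)
    fix p q assume "p < dim_row (?A * E)" and "q < dim_col (?A * E)"
    then have p: "p < Suc k" and q: "q < Suc k"
      using E by (auto simp: bordered_def)
    have "(?A * E) $$ (p, q) = (\<Sum>t<Suc k. ?A $$ (p, t) * E $$ (t, q))"
      using p q E by (simp add: scalar_prod_def lessThan_atLeast0 bordered_def)
    also have "\<dots> = (\<Sum>t<k. ?A $$ (p, t) * (if t = q then 1 else 0)) + ?A $$ (p, k) * E $$ (k, q)"
      unfolding sum.lessThan_Suc using q
      by (intro arg_cong2 [where f = "(+)"] sum.cong) (auto simp: E_def)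
    also have "\<dots> = ?B $$ (p, q)"
      using p q assms
      by (auto simp: bordered_def append_col_def E_def entry less_Suc_eq if_distrib [of "(*) _"] cong: if_cong)
    finally show "?B $$ (p, q) = (?A * E) $$ (p, q)" ..
  qed (use E in \<open>auto simp: bordered_def\<close>)
  moreover have "det E = 1"
    by (subst det_lower_triangular [OF _ E]) (auto simp: E_def prod_list_diag_prod)
  ultimately have "det ?B = det ?A"
    using det_mult [OF _ E, of ?A] by simp
  moreover have "leading_principal_minor (append_col n A v) t \<noteq> 0"
    "leading_principal_minor (append_col n B v) t \<noteq> 0" if "1 \<le> t" "t \<le> k" for t
    using that assms by (simp_all add: leading_principal_minor_append_col minor_A minor_B)
  ultimately show ?thesis
    using assms by (simp add: ipge_eq_det_bordered)
qed

lemma y_Ints: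
  assumes "k < i" "i \<le> n"
  shows "y k i \<in> \<int>"
proof -
  have "leading_principal_minor (append_col n A v) t \<noteq> 0" if "1 \<le> t" "t \<le> k" for t
    using that assms by (simp add: leading_principal_minor_append_col minor_A)
  then show ?thesis using assms by (simp add: ipge_eq_det_bordered)
qed

lemma y_step:
  assumes "Suc k < i" "i \<le> n"
  shows "pivot A (Suc k) * y k i - ipge A k i (Suc k) * y k (Suc k) = y (Suc k) i * pivot A k"
proof -
  have "leading_principal_minor (append_col n A v) t \<noteq> 0" if "1 \<le> t" "t \<le> k" for t
    using that assms by (simp add: leading_principal_minor_append_col minor_A)
  from ipge_step [OF this assms(1), of "Suc n"] show ?thesis
    using assms by (simp add: ipge_append_col mult.commute)
qed

text \<open>By \<open>y_updated\<close> the elimination step for the appended column may be read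
  with the coefficients of \<open>B\<close>; the unknown off-diagonal entry is then
  isolated.\<close>

lemma offdiag_identity:
  assumes "Suc k < i" "i \<le> n"
  shows "pivot B (Suc k) * y k i - pivot B k * y (Suc k) i = ipge B k i (Suc k) * y k (Suc k)"
proof -
  have "leading_principal_minor (append_col n B v) t \<noteq> 0" if "1 \<le> t" "t \<le> k" for t
    using that assms by (simp add: leading_principal_minor_append_col minor_B)
  from ipge_step [OF this assms(1), of "Suc n"] show ?thesis
    using assms by (simp add: ipge_append_col y_updated algebra_simps)
qed

lemma diag_identity:
  assumes "Suc k < i" "i \<le> n"
  shows "pivot B (Suc k) * ipge B k i i - ipge B k (Suc k) i * ipge B k i (Suc k)
    = ipge B (Suc k) i i * pivot B k"
  using assms by (intro ipge_step) (auto simp: minor_B)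

end

section \<open>Exact division and loops with known states\<close>

lemma xdiv_eq_Some:
  assumes "a = x * b" "x \<in> \<int>" "b \<in> \<int>" "b \<noteq> 0"
  shows "exact_division a b" and "xdiv a b = Some x"
proof -
  obtain p q :: int where "x = of_int p" "b = of_int q"
    using assms(2,3) by (auto elim!: Ints_cases)
  then show "exact_division a b"
    using assms(1,4) unfolding exact_division_def
    by (intro exI [of _ "p * q"] exI [of _ q]) auto
  then show "xdiv a b = Some x"
    using assms(1,4) by (simp add: xdiv_def)
qed

lemma for_loop_Some:
  assumes "a \<le> b" and "\<And>i. \<lbrakk>a \<le> i; i < b\<rbrakk> \<Longrightarrow> body i (S i) = Some (S (Suc i))"
  shows "for_loop [a..<b] body (S a) = Some (S b)"
proof -
  \<comment> \<open>Induction on the number \<open>d\<close> of remaining iterations, since the loop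
    consumes its list from the front.\<close>
  have "for_loop [b - d..<b] body (S (b - d)) = Some (S b)" if "d \<le> b - a" for d
    using that
  proof (induction d)
    case (Suc d)
    then have "Suc (b - Suc d) = b - d" "b - Suc d < b" "a \<le> b - Suc d" by auto
    then show ?case using Suc assms(2) [of "b - Suc d"] by (simp add: upt_conv_Cons)
  qed simp
  from this [of "b - a"] show ?thesis using assms(1) by simp
qed

section \<open>The states of the algorithm\<close>

text \<open>The working array after stage \<open>k\<close>, with stage 1 the initialization. A
  diagonal entry is updated once per stage until it becomes a pivot, whence
  \<open>min i k - 1\<close>.\<close>

definition rou_lower :: "nat \<Rightarrow> int mat \<Rightarrow> nat \<Rightarrow> array" where
  "rou_lower n M k i j =
     (if i = 0 \<and> j = 0 then 1
      else if i = j \<and> i \<le> n then ipge M (min i k - 1) i i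
      else if 1 \<le> j \<and> j < i \<and> i \<le> n \<and> j \<le> k then ipge M (j - 1) i j
      else 0)"

lemma rou_lower_diag: "\<lbrakk>i \<le> k; i \<le> n\<rbrakk> \<Longrightarrow> rou_lower n M k i i = pivot M i"
  by (cases i) (auto simp: rou_lower_def pivot.simps)

lemma rou_lower_row:
  assumes "1 \<le> k" "Suc k \<le> i" "i \<le> n"
  shows "rou_lower n M (Suc k) i = (\<lambda>j. if j = i then ipge M k i i
    else if j = Suc k then ipge M k i (Suc k) else rou_lower n M k i j)"
  using assms by (auto simp: rou_lower_def min_def fun_eq_iff)

lemma rou_lower_row_same:
  assumes "i < k \<or> n < i"
  shows "rou_lower n M k i = rou_lower n M (k - 1) i"
  using assms by (auto simp: rou_lower_def min_def fun_eq_iff)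

text \<open>The arrays in iteration \<open>k\<close> of the outer loop, before the inner loop reaches index \<open>m\<close>.\<close>

definition rou_state :: "nat \<Rightarrow> int mat \<Rightarrow> nat \<Rightarrow> nat \<Rightarrow> array \<times> array" where
  "rou_state n M k m =
     (\<lambda>i j. rou_lower n M (if i < m then k else k - 1) i j,
      \<lambda>i j. rou_lower n (transpose_mat M) (if j < m then k else k - 1) j i)"

text \<open>Rows before \<open>k\<close> are unchanged by stage \<open>k\<close>, and so are those
  beyond \<open>n\<close>. The mixed state is therefore a pure stage at both ends of the inner loop,
  and the end of stage \<open>k\<close> is the start of stage \<open>Suc k\<close>.\<close>

lemma rou_state_first:
  "rou_state n M k k =
     (rou_lower n M (k - 1), \<lambda>i j. rou_lower n (transpose_mat M) (k - 1) j i)"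
  unfolding rou_state_def using rou_lower_row_same [of _ k n] by (auto simp: fun_eq_iff)

lemma rou_state_last:
  "rou_state n M k (Suc n) =
     (rou_lower n M k, \<lambda>i j. rou_lower n (transpose_mat M) k j i)"
  unfolding rou_state_def using rou_lower_row_same [of _ k n] by (auto simp: fun_eq_iff)

section \<open>Exactness and effect of each operation\<close>

context rank_one_update
begin

text \<open>By \<open>y_step\<close> the quotient is \<open>y (Suc k) i\<close>, a bordered minor
  and so an integer; the divisor is a pivot of \<open>A\<close>.\<close>

lemma ref_step_exact_fwd_subst:
  assumes \<Lambda>: "\<And>i j. \<lbrakk>1 \<le> j; j \<le> i; i \<le> n\<rbrakk> \<Longrightarrow> mat_ent \<Lambda> i j = ipge A (j - 1) i j"
    and k: "Suc k < n"
  shows "ref_step_exact n \<Lambda> (Suc k) (fwd_subst \<Lambda> v k) = Some (fwd_subst \<Lambda> v (Suc k))"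
proof -
  have "mat_ent \<Lambda> k k = pivot A k"
    using \<Lambda> [of k k] k by (cases k) (auto simp: mat_ent_def pivot.simps)
  then have "exact_division
      (mat_ent \<Lambda> (Suc k) (Suc k) * fwd_subst \<Lambda> v k i - mat_ent \<Lambda> i (Suc k) * fwd_subst \<Lambda> v k (Suc k))
      (mat_ent \<Lambda> k k)" if "Suc k < i" "i \<le> n" for i
    using that k y_step [of k i] \<Lambda> [of "Suc k" "Suc k"] \<Lambda> [of "Suc k" i]
    by (intro xdiv_eq_Some(1) [where x = "y (Suc k) i"])
      (auto simp: fwd_subst_eq_ipge [OF \<Lambda>] pivot.simps(2) y_Ints pivot_Ints pivots_nonzero)
  then show ?thesis by (simp add: ref_step_exact_def)
qed

text \<open>At inner index \<open>i\<close>, row \<open>i\<close> of \<open>l\<close> and column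
  \<open>i\<close> of \<open>u\<close> still belong to stage \<open>k - 1\<close>, while the two
  earlier diagonal entries that are read are final pivots. This is the setting of
  \<open>diag_identity\<close>.\<close>

lemma rou_diag_state:
  assumes "2 \<le> k" "k \<le> i" "i \<le> n" "rou_state n B k i = (l, u)"
  shows "rou_diag k i (l, u) =
    Some (update l i i (ipge B (k - 1) i i), update u i i (ipge B (k - 1) i i))"
proof -
  \<comment> \<open>For \<open>k = 2\<close> this gives \<open>m = 0\<close>, and the divisor is the
    stored entry 1 at (0, 0).\<close>
  obtain m where k: "k = Suc (Suc m)"
    using assms(1) by (metis One_nat_def Suc_1 Suc_le_D Suc_le_mono)
  have l: "l p q = rou_lower n B (if p < i then k else Suc m) p q"
    and u: "u p q = rou_lower n (transpose_mat B) (if q < i then k else Suc m) q p" for p q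
    using assms(4) k by (auto simp: rou_state_def)
  have "l (Suc m) (Suc m) = pivot B (Suc m)" "l m m = pivot B m"
    using assms k by (auto simp: l rou_lower_diag)
  moreover have "l i i = ipge B m i i" "l i (Suc m) = ipge B m i (Suc m)"
    "u (Suc m) i = ipge B m (Suc m) i"
    using assms k by (auto simp: l u rou_lower_def ipge_transpose [OF carrier(2)])
  ultimately have "xdiv (l (k - 1) (k - 1) * l i i - u (k - 1) i * l i (k - 1)) (l (k - 2) (k - 2))
      = Some (ipge B (Suc m) i i)"
    using assms k
    by (intro xdiv_eq_Some(2)) (auto simp: diag_identity ipge_Ints pivot_Ints pivots_nonzero)
  then show ?thesis using k by (simp add: rou_diag_def)
qed

text \<open>For \<open>i = k\<close> the diagonal position and column \<open>k\<close> coincide, so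
  one update completes the row.\<close>

lemma rou_diag_pivot:
  assumes "2 \<le> k" "k \<le> n"
  shows "rou_diag k k (rou_state n B k k) = Some (rou_state n B k (Suc k))"
proof -
  obtain l u where lu: "rou_state n B k k = (l, u)" by fastforce
  obtain m where k: "k = Suc m" "1 \<le> m"
    using assms(1) by (cases k) auto
  have l: "l p q = rou_lower n B (if p < k then k else m) p q"
    and u: "u p q = rou_lower n (transpose_mat B) (if q < k then k else m) q p" for p q
    using lu k by (auto simp: rou_state_def)
  have "(update l k k (ipge B (k - 1) k k), update u k k (ipge B (k - 1) k k)) = rou_state n B k (Suc k)"
    using assms k
    by (auto simp: rou_state_def update_def fun_eq_iff l u rou_lower_row ipge_transpose [OF carrier(2)]
        less_Suc_eq)
  then show ?thesis using rou_diag_state [OF assms(1) _ assms(2) lu] lu by simp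
qed

lemma offdiag_xdiv:
  assumes "Suc k < i" "i \<le> n" "y k (Suc k) \<noteq> 0"
  shows "xdiv (pivot B (Suc k) * y k i - pivot B k * y (Suc k) i) (y k (Suc k))
    = Some (ipge B k i (Suc k))"
  using assms by (intro xdiv_eq_Some(2)) (auto simp: offdiag_identity ipge_Ints y_Ints)

text \<open>The vectors are constrained only at the indices where \<open>fwd_subst_eq_ipge\<close>
  identifies them with the appended column.\<close>

lemma rou_inner_body:
  assumes k: "2 \<le> k" "k < n" and i: "k \<le> i" "i \<le> n"
    and Y: "\<And>i. \<lbrakk>k \<le> i; i \<le> n\<rbrakk> \<Longrightarrow> Y i = y (k - 1) i" "\<And>i. \<lbrakk>k < i; i \<le> n\<rbrakk> \<Longrightarrow> Y' i = y k i"
    and Z: "\<And>i. \<lbrakk>k \<le> i; i \<le> n\<rbrakk> \<Longrightarrow> Z i = rank_one_update.y n (transpose_mat A) w (k - 1) i"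
      "\<And>i. \<lbrakk>k < i; i \<le> n\<rbrakk> \<Longrightarrow> Z' i = rank_one_update.y n (transpose_mat A) w k i"
    and nz: "Y k \<noteq> 0" "Z k \<noteq> 0"
  shows "do { lu' \<leftarrow> rou_diag k i (rou_state n B k i);
      if i > k then rou_offdiag k Y Y' Z Z' i lu' else Some lu' } = Some (rou_state n B k (Suc i))"
proof (cases "i = k")
  case True
  then show ?thesis using rou_diag_pivot k by simp
next
  case False
  interpret T: rank_one_update n "transpose_mat A" "transpose_mat B" w v
    by (rule transposed)
  obtain l u where lu: "rou_state n B k i = (l, u)" by fastforce
  obtain m where m: "k = Suc m" "1 \<le> m"
    using k(1) by (cases k) auto
  let ?d = "ipge B m i i"
  have l: "l p q = rou_lower n B (if p < i then k else m) p q"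
    and u: "u p q = rou_lower n (transpose_mat B) (if q < i then k else m) q p" for p q
    using lu m by (auto simp: rou_state_def)
  \<comment> \<open>Row \<open>k\<close> was completed by the first inner pass \<open>i = k\<close>,
    so the final pivot is available here. The entries of \<open>u\<close> are stated for the
    transpose to fit \<open>T.offdiag_xdiv\<close>.\<close>
  have "l k k = pivot B k" "l m m = pivot B m"
    "u k k = pivot (transpose_mat B) k" "u m m = pivot (transpose_mat B) m"
    using False k i m by (auto simp: l u rou_lower_diag)
  then have "rou_offdiag k Y Y' Z Z' i (update l i i ?d, update u i i ?d) =
      Some (update (update l i i ?d) i k (ipge B m i k),
        update (update u i i ?d) k i (ipge (transpose_mat B) m i k))"
    using False k i m nz Y(1) [of k] Y(1) [of i] Y(2) [of i] Z(1) [of k] Z(1) [of i] Z(2) [of i]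
    by (simp add: rou_offdiag_def update_def offdiag_xdiv T.offdiag_xdiv)
  also have "(update (update l i i ?d) i k (ipge B m i k),
        update (update u i i ?d) k i (ipge (transpose_mat B) m i k)) = rou_state n B k (Suc i)"
    using False i m
    by (auto simp: rou_state_def update_def fun_eq_iff l u rou_lower_row
        ipge_transpose [OF carrier(2)] less_Suc_eq)
  finally show ?thesis
    using rou_diag_state [OF k(1) i lu] False i lu m by simp
qed

text \<open>Before any elimination the entries are those of \<open>B\<close> itself, namely those of
  \<open>A\<close> plus products of the vectors. By \<open>rou_state_first\<close> the right-hand
  side is stage 1.\<close>

lemma rou_init_eq:
  assumes "1 \<le> n"
    and L: "\<And>i. \<lbrakk>1 \<le> i; i \<le> n\<rbrakk> \<Longrightarrow> mat_ent L i 1 = ipge A 0 i 1"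
    and U: "\<And>i. \<lbrakk>1 \<le> i; i \<le> n\<rbrakk> \<Longrightarrow> mat_ent U 1 i = ipge A 0 1 i"
  shows "rou_init n L U v w (vec n (\<lambda>i. A $$ (i, i))) = rou_state n B 2 2"
proof -
  have B: "ipge B 0 i j = ipge A 0 i j + vec_ent v i * vec_ent w j"
    "ipge (transpose_mat B) 0 i j = ipge A 0 j i + vec_ent v j * vec_ent w i"
    if "1 \<le> i" "i \<le> n" "1 \<le> j" "j \<le> n" for i j
    using that carrier by (auto simp: ipge.simps vec_ent_def entry)
  have a: "vec_ent (vec n (\<lambda>i. A $$ (i, i))) i = ipge A 0 i i" if "1 \<le> i" "i \<le> n" for i
    using that by (auto simp: ipge.simps vec_ent_def)
  show ?thesis
    unfolding rou_state_first rou_init_def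
    using assms(1)
    by (auto simp: rou_lower_def fun_eq_iff B a L [simplified] U [simplified] min_def)
qed

end

section \<open>Assembly of the complete run\<close>

theorem theorem7:
  fixes n :: nat and A Ahat :: "int mat" and v w :: "int vec"
    and L D U Lhat Dhat Uhat :: "rat mat" and y z :: "nat \<Rightarrow> nat \<Rightarrow> rat"
  assumes "n \<ge> 2"
    and "A \<in> carrier_mat n n" and "v \<in> carrier_vec n" and "w \<in> carrier_vec n"
    and "Ahat = A + mat_of_cols n [v] * mat_of_rows n [w]"
    and "\<forall>k\<in>{1..n}. leading_principal_minor A k \<noteq> 0"
    and "\<forall>k\<in>{1..n}. leading_principal_minor Ahat k \<noteq> 0"
    and "REF_LU A = (L, D, U)"
    and "REF_LU Ahat = (Lhat, Dhat, Uhat)"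
    and "y = fwd_subst L v"
    and "z = fwd_subst (transpose_mat U) w"
    and "\<forall>k\<in>{2..n - 1}. y (k - 1) k \<noteq> 0 \<and> z (k - 1) k \<noteq> 0"
  shows "REF_ROU n L U v w (vec n (\<lambda>i. A $$ (i, i))) = Some (Lhat, Uhat)"
proof -
  have L: "mat_ent L i j = ipge A (j - 1) i j"
    and U: "mat_ent U j i = ipge A (j - 1) j i" if "1 \<le> j" "j \<le> i" "i \<le> n" for i j
    using assms(2,8) that by (auto simp: REF_LU_def Let_def mat_ent_def mat_of_ent_def)
  have UT: "mat_ent (transpose_mat U) i j = ipge (transpose_mat A) (j - 1) i j"
    if "1 \<le> j" "j \<le> i" "i \<le> n" for i j
  proof -
    have "U \<in> carrier_mat n n"
      using assms(2,8) by (auto simp: REF_LU_def Let_def mat_of_ent_def)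
    then have "mat_ent (transpose_mat U) i j = mat_ent U j i"
      using that by (auto simp: mat_ent_def)
    then show ?thesis
      using that by (simp add: U ipge_transpose [OF assms(2)])
  qed
  interpret rank_one_update n A Ahat v w
    using assms(2-7) by unfold_locales
      (auto simp: scalar_prod_def mat_of_cols_index mat_of_rows_index)
  interpret T: rank_one_update n "transpose_mat A" "transpose_mat Ahat" w v
    by (rule transposed)
  \<comment> \<open>The state on entering outer iteration \<open>k\<close>: the vectors have
    undergone \<open>k - 1\<close> steps and the arrays are at stage \<open>k - 1\<close>.\<close>
  define S where "S k = (fwd_subst L v (k - 1), fwd_subst (transpose_mat U) w (k - 1),
    rou_state n Ahat k k)" for k
  have init: "rou_init n L U v w (vec n (\<lambda>i. A $$ (i, i))) = rou_state n Ahat 2 2"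
    using assms(1) L [of 1] U [of 1] by (intro rou_init_eq) auto
  have step: "ref_step_exact n L k (fwd_subst L v (k - 1)) = Some (fwd_subst L v k)"
    "ref_step_exact n (transpose_mat U) k (fwd_subst (transpose_mat U) w (k - 1))
      = Some (fwd_subst (transpose_mat U) w k)" if "1 \<le> k" "k < n" for k
    using that ref_step_exact_fwd_subst [OF L, of "k - 1"]
      T.ref_step_exact_fwd_subst [OF UT, of "k - 1"] by auto
  let ?body = "\<lambda>k (y, z, lu). do {
         y' \<leftarrow> ref_step_exact n L k y;
         z' \<leftarrow> ref_step_exact n (transpose_mat U) k z;
         lu' \<leftarrow> for_loop [k..<n + 1] (\<lambda>i lu. do {
             lu' \<leftarrow> rou_diag k i lu;
             if i > k then rou_offdiag k y y' z z' i lu' else Some lu' }) lu;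
         Some (y', z', lu') }"
  have "?body k (S k) = Some (S (Suc k))" if k: "2 \<le> k" "k < n" for k
  proof -
    have "for_loop [k..<n + 1] (\<lambda>i lu. do {
        lu' \<leftarrow> rou_diag k i lu;
        if i > k then rou_offdiag k (fwd_subst L v (k - 1)) (fwd_subst L v k)
          (fwd_subst (transpose_mat U) w (k - 1)) (fwd_subst (transpose_mat U) w k) i lu'
        else Some lu' }) (rou_state n Ahat k k) = Some (rou_state n Ahat k (n + 1))"
    proof (rule for_loop_Some)
      fix i assume "k \<le> i" "i < n + 1"
      then show "do { lu' \<leftarrow> rou_diag k i (rou_state n Ahat k i);
        if i > k then rou_offdiag k (fwd_subst L v (k - 1)) (fwd_subst L v k)
          (fwd_subst (transpose_mat U) w (k - 1)) (fwd_subst (transpose_mat U) w k) i lu'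
        else Some lu' } = Some (rou_state n Ahat k (Suc i))"
        using k assms(10-12)
        by (intro rou_inner_body)
          (auto intro!: fwd_subst_eq_ipge [OF L] fwd_subst_eq_ipge [OF UT])
    qed (use k in simp)
    moreover have "rou_state n Ahat k (n + 1) = rou_state n Ahat (Suc k) (Suc k)"
      by (simp add: rou_state_first rou_state_last)
    ultimately show ?thesis using k step [of k] by (simp add: S_def del: One_nat_def upt_Suc)
  qed
  then have loop: "for_loop [2..<n] ?body (S 2) = Some (S n)"
    by (rule for_loop_Some [OF assms(1)])
  \<comment> \<open>The closing update is the pass \<open>i = k = n\<close>, where no off-diagonal
    entry remains to be computed.\<close>
  have "rou_diag n n (rou_state n Ahat n n) = Some (rou_state n Ahat n (Suc n))"
    using assms(1) by (intro rou_diag_pivot) auto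
  then have "REF_ROU n L U v w (vec n (\<lambda>i. A $$ (i, i))) =
      Some (mat_of_ent n (rou_lower n Ahat n),
        mat_of_ent n (\<lambda>i j. rou_lower n (transpose_mat Ahat) n j i))"
    using loop init step [of 1] assms(1)
    by (simp add: REF_ROU_def S_def rou_state_last numeral_2_eq_2)
  also have "mat_of_ent n (rou_lower n Ahat n) = Lhat"
    using assms(9) carrier
    by (auto simp: REF_LU_def Let_def mat_of_ent_def rou_lower_def intro!: eq_matI)
  also have "mat_of_ent n (\<lambda>i j. rou_lower n (transpose_mat Ahat) n j i) = Uhat"
    using assms(9) carrier
    by (auto simp: REF_LU_def Let_def mat_of_ent_def rou_lower_def ipge_transpose [OF carrier(2)]
        intro!: eq_matI)
  finally show ?thesis .
qed

end
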